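(* Let $q$ be a prime power and $m,n$ positive integers. If $\mathbf{c}_1,\mathbf{c}_2\in\mathrm{GF}(q^m)^n$ and $d_R(\mathbf{c}_1,\mathbf{c}_2)=r$, then for $0\le s\le r$, $$|B_s(\mathbf{c}_1)\cap B_{r-s}(\mathbf{c}_2)| = q^{s(r-s)}{r\brack s}.$$
   Context: For $\mathbf{x}\in \mathrm{GF}(q^m)^n$, $\mathrm{rk}(\mathbf{x})$ is the maximum number of coordinates of $\mathbf{x}$ that are linearly independent over $\mathrm{GF}(q)$; the rank distance is $d_R(\mathbf{x},\mathbf{y})=\mathrm{rk}(\mathbf{x}-\mathbf{y})$; $B_r(\mathbf{x})$ is the set of all vectors in $\mathrm{GF}(q^m)^n$ within rank distance $r$ of $\mathbf{x}$. ${n\brack u}=\prod_{i=0}^{u-1}\frac{q^n-q^i}{q^u-q^i}$ is the Gaussian binomial coefficient. *)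

theory Defs
  imports Complex_Main "HOL-Number_Theory.Prime_Powers" "HOL-Algebra.Embedded_Algebras"
begin

text \<open>
  The field \<open>GF(q\<^sup>m)\<close> is a finite field \<open>R\<close>, and \<open>GF(q)\<close> is a subfield \<open>K\<close> of it.
  Vectors over \<open>R\<close> are lists.
\<close>

definition vectors :: "('a, 'b) ring_scheme \<Rightarrow> nat \<Rightarrow> 'a list set"
  where "vectors R n = {x. length x = n \<and> set x \<subseteq> carrier R}"

text \<open>
  Independence is asked of the subfamily of coordinates selected by an index set; a family
  with a repeated entry is dependent.
\<close>

definition rk :: "('a, 'b) ring_scheme \<Rightarrow> 'a set \<Rightarrow> 'a list \<Rightarrow> nat"
  where "rk R K x = Max {card I | I. I \<subseteq> {..<length x} \<and> ring.independent R K (nths x I)}"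

definition rank_dist :: "('a, 'b) ring_scheme \<Rightarrow> 'a set \<Rightarrow> 'a list \<Rightarrow> 'a list \<Rightarrow> nat"
  where "rank_dist R K x y = rk R K (map2 (\<lambda>a b. a \<ominus>\<^bsub>R\<^esub> b) x y)"

definition rank_ball :: "('a, 'b) ring_scheme \<Rightarrow> 'a set \<Rightarrow> nat \<Rightarrow> nat \<Rightarrow> 'a list \<Rightarrow> 'a list set"
  where "rank_ball R K n r x = {y \<in> vectors R n. rank_dist R K x y \<le> r}"

definition gauss_binomial :: "nat \<Rightarrow> nat \<Rightarrow> nat \<Rightarrow> real"
  where "gauss_binomial q n u =
    (\<Prod>i<u. (real q ^ n - real q ^ i) / (real q ^ u - real q ^ i))"

end

theory Submission
  imports Defs
begin

text \<open>
  For \<open>z\<close> in the intersection, the \<open>K\<close>-spans \<open>U\<close> of \<open>c\<^sub>1 - z\<close> and \<open>W\<close> of \<open>c\<^sub>2 - z\<close> have dimensions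
  at most \<open>s\<close> and \<open>r - s\<close>, while \<open>U + W\<close> contains the \<open>r\<close>-dimensional span \<open>V\<close> of \<open>c\<^sub>1 - c\<^sub>2\<close>.
  Hence \<open>V = U \<oplus> W\<close>, and conversely such a decomposition determines \<open>z\<close>, because \<open>c\<^sub>1 - z\<close> is the
  projection of \<open>c\<^sub>1 - c\<^sub>2\<close> to \<open>U\<close>. Concatenating an ordered basis of \<open>U\<close> with one of \<open>W\<close> therefore
  gives every ordered basis of \<open>V\<close> exactly once; since a \<open>d\<close>-dimensional space has
  \<open>\<Prod>i<d. q\<^sup>d - q\<^sup>i\<close> ordered bases, the number of \<open>z\<close> is a quotient of such products.
\<close>

section \<open>Ordered bases and the product that counts them\<close>

definition (in ring) bases :: "'a set \<Rightarrow> 'a set \<Rightarrow> 'a list set"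
  where "bases K E = {Us. independent K Us \<and> Span K Us = E}"

text \<open>Real-valued, so that subtraction is not truncated and quotients can be formed.\<close>

definition frame_count :: "nat \<Rightarrow> nat \<Rightarrow> real"
  where "frame_count q d = (\<Prod>i<d. real q ^ d - real q ^ i)"

context embedded_algebra
begin

declare Span.simps [simp del]

lemma subf: "subfield K R"
  by (rule K.subfield_axioms)

lemma a_minus_in_Span:
  assumes "set Us \<subseteq> carrier R" "u \<in> Span K Us" "v \<in> Span K Us"
  shows "u \<ominus> v \<in> Span K Us"
  using Span_subgroup_props[OF subf assms(1)] assms(2,3) by (simp add: a_minus_def)

section \<open>Rank as the dimension of the span of the coordinates\<close>

text \<open>Greedy choice from the right: an entry is kept exactly when it lies outside the span of
  the entries after it. This links the index sets in \<open>rk\<close> with spans.\<close>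

lemma exists_nths_base:
  assumes "set x \<subseteq> carrier R"
  obtains I where "I \<subseteq> {..<length x}" "independent K (nths x I)" "Span K (nths x I) = Span K x"
  using assms
proof (induction x arbitrary: thesis)
  case Nil
  show ?case by (rule Nil(1)[of "{}"]) auto
next
  case (Cons u xs)
  obtain I where I: "I \<subseteq> {..<length xs}" "independent K (nths xs I)"
      "Span K (nths xs I) = Span K xs"
    using Cons.IH Cons.prems(2) by auto
  show ?case
  proof (cases "u \<in> Span K xs")
    case True
    have carr: "set xs \<subseteq> carrier R" "set (u # xs) \<subseteq> carrier R" using Cons.prems(2) by auto
    \<comment> \<open>Prepending \<open>u\<close> shifts the selected indices by one; index
      \<open>0\<close> joins them only if \<open>u\<close> is kept.\<close>
    have eq: "nths (u # xs) (Suc ` I) = nths xs I"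
      by (simp add: nths_Cons image_iff)
    have "Span K (u # xs) \<subseteq> Span K xs"
      by (rule mono_Span_subset[OF subf])
        (use True Span_base_incl[OF subf carr(1)] carr in auto)
    then have "Span K (u # xs) = Span K xs"
      using mono_Span[OF subf carr(1), of u] carr by auto
    then show ?thesis
      using Cons.prems(1)[of "Suc ` I"] I eq by auto
  next
    case False
    have eq: "nths (u # xs) (insert 0 (Suc ` I)) = u # nths xs I"
      by (simp add: nths_Cons image_iff)
    have "independent K (u # nths xs I)"
      by (rule li_Cons) (use False I Cons.prems(2) in auto)
    moreover have "Span K (u # nths xs I) = Span K (u # xs)"
      using I(3) by (simp add: Span.simps)
    moreover have "insert 0 (Suc ` I) \<subseteq> {..<length (u # xs)}" using I(1) by auto
    ultimately show ?thesis
      using Cons.prems(1)[of "insert 0 (Suc ` I)"] eq by metis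
  qed
qed

lemma length_nths_subset: "I \<subseteq> {..<length x} \<Longrightarrow> length (nths x I) = card I"
  by (auto simp: length_nths intro: arg_cong[where f = card])

text \<open>A selection of coordinates forming a basis of \<open>Span K x\<close> attains the
  maximum in \<open>rk\<close>, since every independent selection lies in that span and so cannot be
  longer.\<close>

lemma dimension_rk:
  assumes "set x \<subseteq> carrier R"
  shows "dimension (rk R K x) K (Span K x)"
proof -
  let ?S = "{card I | I. I \<subseteq> {..<length x} \<and> independent K (nths x I)}"
  obtain I where I: "I \<subseteq> {..<length x}" "independent K (nths x I)" "Span K (nths x I) = Span K x"
    using exists_nths_base[OF assms] .
  have dim: "dimension (card I) K (Span K x)"
    using dimensionI[OF subf I(2,3)] length_nths_subset[OF I(1)] by simp
  have "k \<le> card I" if "k \<in> ?S" for k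
  proof -
    obtain J where J: "J \<subseteq> {..<length x}" "independent K (nths x J)" "k = card J"
      using \<open>k \<in> ?S\<close> by auto
    have "set (nths x J) \<subseteq> Span K x"
      using set_nths_subset[of x J] Span_base_incl[OF subf assms] by auto
    then show ?thesis
      using independent_length_le_dimension[OF subf dim J(2)] J length_nths_subset[OF J(1)] by simp
  qed
  \<comment> \<open>The bound also yields finiteness, without which \<open>Max\<close> would be
    unspecified.\<close>
  moreover from this have "finite ?S"
    by (meson atMost_iff finite_atMost finite_subset subsetI)
  ultimately have "Max ?S = card I"
    using I by (intro Max_eqI) auto
  then show ?thesis
    using dim by (simp add: rk_def)
qed

text \<open>A basis selected from \<open>Xs\<close> has at least \<open>length Vs\<close> entries,
  because its span contains the independent list \<open>Vs\<close>. As \<open>Xs\<close> is no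
  longer than \<open>Vs\<close>, the selection drops nothing.\<close>

lemma spanning_imp_base:
  assumes "independent K Vs" "set Xs \<subseteq> carrier R"
    and "Span K Vs \<subseteq> Span K Xs" "length Xs \<le> length Vs"
  shows "length Xs = length Vs" "Xs \<in> bases K (Span K Vs)"
proof -
  have Vs: "set Vs \<subseteq> Span K Xs"
    using Span_base_incl[OF subf independent_in_carrier[OF assms(1)]] assms(3) by blast
  obtain I where I: "I \<subseteq> {..<length Xs}" "independent K (nths Xs I)"
      "Span K (nths Xs I) = Span K Xs"
    using exists_nths_base[OF assms(2)] .
  have dim: "dimension (card I) K (Span K Xs)"
    using dimensionI[OF subf I(2,3)] length_nths_subset[OF I(1)] by simp
  have le: "length Vs \<le> card I"
    using independent_length_le_dimension[OF subf dim assms(1) Vs] .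
  have "card I \<le> length Xs"
    using card_mono[OF _ I(1)] by simp
  then have eq: "length Vs = card I" "card I = length Xs"
    using le assms(4) by auto
  show "length Xs = length Vs" using eq by simp
  have "I = {..<length Xs}"
    using card_subset_eq[OF _ I(1)] eq by simp
  then have "nths Xs I = Xs" by (simp add: nths_upt_eq_take)
  then show "Xs \<in> bases K (Span K Vs)"
    using I independent_length_eq_dimension[OF subf dim assms(1) Vs] eq by (simp add: bases_def)
qed

section \<open>Counting ordered bases over a finite field\<close>

text \<open>With respect to a basis, vectors of \<open>E\<close> correspond bijectively to
  coefficient lists over \<open>K\<close>.\<close>

lemma card_dimension:
  assumes "finite K" "dimension n K E"
  shows "card E = card K ^ n"
proof -
  obtain Us where Us: "set Us \<subseteq> carrier R" "independent K Us" "length Us = n" "Span K Us = E"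
    using exists_base[OF subf assms(2)] by auto
  let ?L = "{Ks. set Ks \<subseteq> K \<and> length Ks = n}"
  have E: "E = (\<lambda>Ks. combine Ks Us) ` ?L"
    using Span_eq_combine_set_length_version[OF subf Us(1)] Us(3,4) by auto
  have "inj_on (\<lambda>Ks. combine Ks Us) ?L"
    using unique_decomposition[OF subf Us(2)] Us(3,4) E by (intro inj_onI) blast
  then show ?thesis
    using card_image[of "\<lambda>Ks. combine Ks Us" ?L] card_lists_length_eq[OF assms(1), of n] E by simp
qed

text \<open>Lists grow at the head: an independent list of length \<open>k\<close> spans
  \<open>card K ^ k\<close> vectors, and any other vector of \<open>E\<close> extends it.\<close>

lemma card_independent_lists:
  assumes "finite (carrier R)" "dimension n K E" "k \<le> n"
  shows "real (card {Us. independent K Us \<and> set Us \<subseteq> E \<and> length Us = k})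
           = (\<Prod>i<k. real (card K) ^ n - real (card K) ^ i)"
  using assms(3)
proof (induction k)
  case 0
  have "{Us. independent K Us \<and> set Us \<subseteq> E \<and> length Us = 0} = {[]}" by auto
  then show ?case by simp
next
  case (Suc k)
  let ?I = "\<lambda>k. {Us. independent K Us \<and> set Us \<subseteq> E \<and> length Us = k}"
  have E: "E \<subseteq> carrier R" and finE: "finite E"
    using space_subgroup_props(1)[OF subf assms(2)] assms(1) finite_subset by auto
  have finK: "finite K"
    using K.subset assms(1) finite_subset by auto
  have sub: "Span K Us \<subseteq> E" if "Us \<in> ?I k" for Us
  proof -
    obtain Vs where "set Vs \<subseteq> carrier R" "Span K Vs = E"
      using exists_base[OF subf assms(2)] by auto
    then show ?thesis using mono_Span_subset[OF subf] that by auto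
  qed
  have card_diff: "card (E - Span K Us) = card K ^ n - card K ^ k" if "Us \<in> ?I k" for Us
  proof -
    have "dimension k K (Span K Us)"
      using dimension_independent that by auto
    then show ?thesis
      using card_Diff_subset[OF finite_subset[OF sub finE] sub] that
        card_dimension[OF finK] assms(2) by simp
  qed
  have "independent K (u # Us) \<longleftrightarrow> u \<in> carrier R \<and> u \<notin> Span K Us \<and> independent K Us" for u Us
    using independent_backwards[of K u Us] li_Cons by blast
  then have "?I (Suc k) = (\<lambda>(Us, u). u # Us) ` (SIGMA Us:?I k. E - Span K Us)"
    using E by (auto simp: length_Suc_conv image_iff)
  moreover have "inj_on (\<lambda>(Us, u). u # Us) (SIGMA Us:?I k. E - Span K Us)"
    by (auto simp: inj_on_def)
  ultimately have "card (?I (Suc k)) = card (SIGMA Us:?I k. E - Span K Us)"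
    by (simp add: card_image)
  also have "\<dots> = card (?I k) * (card K ^ n - card K ^ k)"
  proof -
    have "finite (?I k)"
      by (rule finite_subset[OF _ finite_lists_length_eq[OF finE, of k]]) auto
    then show ?thesis
      using card_diff finE by simp
  qed
  finally have "card (?I (Suc k)) = card (?I k) * (card K ^ n - card K ^ k)" .
  \<comment> \<open>Ensures that the subtraction in \<open>nat\<close> agrees with the one over the
    reals.\<close>
  moreover have "card K ^ k \<le> card K ^ n"
  proof (rule power_increasing)
    show "1 \<le> card K" using finK subring_props(2)[OF subf] card_gt_0_iff[of K] by auto
  qed (use Suc.prems in simp)
  ultimately show ?case
    using Suc by (simp add: of_nat_diff)
qed

text \<open>An independent list in \<open>E\<close> spans \<open>E\<close> exactly when its length
  is \<open>n\<close>.\<close>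

lemma card_bases:
  assumes "finite (carrier R)" "dimension n K E"
  shows "real (card (bases K E)) = frame_count (card K) n"
proof -
  have "bases K E = {Us. independent K Us \<and> set Us \<subseteq> E \<and> length Us = n}"
    unfolding bases_def
    using independent_length_eq_dimension[OF subf assms(2)]
      Span_base_incl[OF subf independent_in_carrier] by blast
  then show ?thesis
    using card_independent_lists[OF assms, of n] by (simp add: frame_count_def)
qed

end

section \<open>The Gaussian binomial as a quotient of basis counts\<close>

lemma prod_lessThan_add:
  fixes f :: "nat \<Rightarrow> 'a::comm_monoid_mult"
  shows "(\<Prod>i<a + b. f i) = (\<Prod>i<a. f i) * (\<Prod>i<b. f (a + i))"
  by (induction b) (simp_all add: mult.assoc)

lemma frame_count_pos:
  assumes "q > 1"
  shows "frame_count q d > 0"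
  unfolding frame_count_def using assms by (intro prod_pos) simp

text \<open>Each of the last \<open>t\<close> factors contains a factor \<open>q ^ s\<close>;
  together these give the power \<open>q ^ (s * t)\<close> of the final formula.\<close>

lemma frame_count_add:
  "frame_count q (s + t) = (\<Prod>i<s. real q ^ (s + t) - real q ^ i) * (real q ^ (s * t) * frame_count q t)"
proof -
  have "(\<Prod>i<t. real q ^ (s + t) - real q ^ (s + i)) = (\<Prod>i<t. real q ^ s * (real q ^ t - real q ^ i))"
    by (simp add: power_add algebra_simps)
  also have "\<dots> = real q ^ (s * t) * frame_count q t"
    by (simp add: prod.distrib power_mult frame_count_def)
  finally show ?thesis
    by (simp add: frame_count_def prod_lessThan_add)
qed

text \<open>The first \<open>s\<close> factors of \<open>frame_count q (s + t)\<close> form the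
  numerator of the Gaussian binomial, whose denominator is \<open>frame_count q s\<close>.\<close>

lemma gauss_binomial_frame_count:
  assumes "q > 1"
  shows "real q ^ (s * t) * gauss_binomial q (s + t) s
           = frame_count q (s + t) / (frame_count q s * frame_count q t)"
  using frame_count_pos[OF assms, of s] frame_count_pos[OF assms, of t] frame_count_add[of q s t]
  by (simp add: gauss_binomial_def prod_dividef frame_count_def[of q s])

context embedded_algebra
begin

section \<open>Direct decompositions coming from points of the intersection\<close>

abbreviation vec_diff :: "'a list \<Rightarrow> 'a list \<Rightarrow> 'a list"
  where "vec_diff x y \<equiv> map2 (\<lambda>a b. a \<ominus> b) x y"

lemma vec_diff_in_carrier:
  assumes "x \<in> vectors R n" "y \<in> vectors R n"
  shows "set (vec_diff x y) \<subseteq> carrier R"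
  using assms by (fastforce simp: vectors_def dest: set_zip_leftD set_zip_rightD)

lemma set_vec_diff:
  assumes "x \<in> vectors R n" "y \<in> vectors R n"
  shows "set (vec_diff x y) = {x ! i \<ominus> y ! i | i. i < n}"
  using assms by (auto simp: vectors_def set_zip)

lemma rank_dist_dimension:
  assumes "x \<in> vectors R n" "y \<in> vectors R n"
  shows "dimension (rank_dist R K x y) K (Span K (vec_diff x y))"
  unfolding rank_dist_def by (rule dimension_rk[OF vec_diff_in_carrier[OF assms]])

lemma length_bases:
  assumes "dimension n K E" "Us \<in> bases K E"
  shows "length Us = n"
  using assms dimension_independent dimension_is_inj[OF subf] unfolding bases_def by blast

lemma bases_in_carrier: "Us \<in> bases K E \<Longrightarrow> set Us \<subseteq> carrier R"
  using independent_in_carrier unfolding bases_def by blast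

text \<open>Coordinatewise, \<open>c1 - c2\<close> is \<open>(c1 - z) - (c2 - z)\<close>, so
  \<open>Us @ Ws\<close> spans a space containing one of dimension \<open>s + t\<close>. It has at
  most \<open>s + t\<close> entries, hence it is a basis and both length bounds are
  attained.\<close>

lemma append_bases:
  assumes c: "c1 \<in> vectors R n" "c2 \<in> vectors R n" and z: "z \<in> vectors R n"
    and d: "rank_dist R K c1 z \<le> s" "rank_dist R K c2 z \<le> t" "rank_dist R K c1 c2 = s + t"
    and B: "Us \<in> bases K (Span K (vec_diff c1 z))" "Ws \<in> bases K (Span K (vec_diff c2 z))"
  shows "Us @ Ws \<in> bases K (Span K (vec_diff c1 c2))" "length Us = s" "length Ws = t"
proof -
  have dim: "dimension (s + t) K (Span K (vec_diff c1 c2))"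
    using rank_dist_dimension[OF c] d(3) by simp
  obtain Vs where Vs: "independent K Vs" "length Vs = s + t" "Span K Vs = Span K (vec_diff c1 c2)"
    using exists_base[OF subf dim] by auto
  have len: "length Us \<le> s" "length Ws \<le> t"
    using length_bases[OF rank_dist_dimension[OF c(1) z] B(1)]
      length_bases[OF rank_dist_dimension[OF c(2) z] B(2)] d by auto
  have carr: "set Us \<subseteq> carrier R" "set Ws \<subseteq> carrier R" "set (Us @ Ws) \<subseteq> carrier R"
    using bases_in_carrier[OF B(1)] bases_in_carrier[OF B(2)] by auto
  have "set (vec_diff c1 c2) \<subseteq> Span K (Us @ Ws)"
  proof
    fix v assume "v \<in> set (vec_diff c1 c2)"
    then obtain i where i: "i < n" "v = c1 ! i \<ominus> c2 ! i"
      using set_vec_diff[OF c] by auto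
    have "c1 ! i \<ominus> z ! i \<in> Span K Us"
      using B(1) Span_base_incl[OF subf vec_diff_in_carrier[OF c(1) z]] i(1)
      unfolding bases_def set_vec_diff[OF c(1) z] by auto
    moreover have "c2 ! i \<ominus> z ! i \<in> Span K Ws"
      using B(2) Span_base_incl[OF subf vec_diff_in_carrier[OF c(2) z]] i(1)
      unfolding bases_def set_vec_diff[OF c(2) z] by auto
    ultimately have "(c1 ! i \<ominus> z ! i) \<ominus> (c2 ! i \<ominus> z ! i) \<in> Span K (Us @ Ws)"
      using a_minus_in_Span[OF carr(3)] mono_Span_append(1)[OF subf carr(1,2)]
        mono_Span_append(2)[OF subf carr(2,1)] by blast
    moreover have "(c1 ! i \<ominus> z ! i) \<ominus> (c2 ! i \<ominus> z ! i) = v"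
    proof -
      have "c1 ! i \<in> carrier R" "c2 ! i \<in> carrier R" "z ! i \<in> carrier R"
        using c z i(1) by (auto simp: vectors_def)
      then show ?thesis unfolding i(2) by algebra
    qed
    ultimately show "v \<in> Span K (Us @ Ws)" by simp
  qed
  then have "Span K Vs \<subseteq> Span K (Us @ Ws)"
    using mono_Span_subset[OF subf _ carr(3)] Vs(3) by simp
  note * = spanning_imp_base[OF Vs(1) carr(3) this]
  show "Us @ Ws \<in> bases K (Span K (vec_diff c1 c2))" using * len Vs by simp
  show "length Us = s" "length Ws = t" using *(1) len Vs by simp_all
qed

lemma Span_eq_if_dimension_eq:
  assumes "dimension n K E" "dimension n K F" "E \<subseteq> F"
  shows "E = F"
proof -
  obtain Us where Us: "independent K Us" "length Us = n" "Span K Us = E"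
    using exists_base[OF subf assms(1)] by auto
  then have "set Us \<subseteq> F"
    using Span_base_incl[OF subf independent_in_carrier[OF Us(1)]] assms(3) by auto
  then show ?thesis
    using independent_length_eq_dimension[OF subf assms(2) Us(1)] Us by simp
qed

text \<open>Used to show that a vector built from a decomposition lies in both balls.\<close>

lemma rk_le_length:
  assumes "independent K Us" "set x \<subseteq> Span K Us"
  shows "rk R K x \<le> length Us"
proof -
  have carr: "set Us \<subseteq> carrier R" using independent_in_carrier[OF assms(1)] .
  then have x: "set x \<subseteq> carrier R"
    using assms(2) Span_subgroup_props(1)[OF subf] by blast
  obtain Vs where Vs: "independent K Vs" "length Vs = rk R K x" "Span K Vs = Span K x"
    using exists_base[OF subf dimension_rk[OF x]] by auto
  have "set Vs \<subseteq> Span K Us"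
    using Span_base_incl[OF subf independent_in_carrier[OF Vs(1)]] Vs(3)
      mono_Span_subset[OF subf assms(2) carr] by auto
  then show ?thesis
    using independent_length_le[OF subf Vs(1) assms(1)] Vs(2) by simp
qed

section \<open>Double counting of bases adapted to a decomposition\<close>

text \<open>The triples in \<open>?P\<close> are counted fibrewise over \<open>z\<close> and,
  through concatenation, as ordered bases of \<open>V\<close>.\<close>

lemma card_rank_ball_inter_bases:
  assumes fin: "finite (carrier R)"
    and c: "c1 \<in> vectors R n" "c2 \<in> vectors R n"
    and d: "rank_dist R K c1 c2 = s + t"
  shows "real (card (rank_ball R K n s c1 \<inter> rank_ball R K n t c2))
           * (frame_count (card K) s * frame_count (card K) t) = frame_count (card K) (s + t)"
proof -
  define A where "A = rank_ball R K n s c1 \<inter> rank_ball R K n t c2"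
  define U where "U = (\<lambda>z. Span K (vec_diff c1 z))"
  define W where "W = (\<lambda>z. Span K (vec_diff c2 z))"
  define V where "V = Span K (vec_diff c1 c2)"
  let ?P = "SIGMA z:A. bases K (U z) \<times> bases K (W z)"
  have dimV: "dimension (s + t) K V"
    using rank_dist_dimension[OF c] d by (simp add: V_def)
  have A: "z \<in> A \<longleftrightarrow> z \<in> vectors R n \<and> rank_dist R K c1 z \<le> s \<and> rank_dist R K c2 z \<le> t" for z
    by (auto simp: A_def rank_ball_def)
  have finA: "finite A"
    by (rule finite_subset[OF _ finite_lists_length_eq[OF fin, of n]]) (auto simp: A vectors_def)
  have app: "Us @ Ws \<in> bases K V" "length Us = s" "length Ws = t"
    if "z \<in> A" "Us \<in> bases K (U z)" "Ws \<in> bases K (W z)" for z Us Ws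
    using append_bases[OF c _ _ _ d] that unfolding A U_def W_def V_def by auto
  \<comment> \<open>Membership in the balls bounds these dimensions from above; the lengths in
    \<open>app\<close> turn the bounds into equalities, so all fibres of \<open>?P\<close> have the
    same size.\<close>
  have dims: "dimension s K (U z)" "dimension t K (W z)" if z: "z \<in> A" for z
  proof -
    have zv: "z \<in> vectors R n" using z by (simp add: A)
    obtain Us Ws where B: "Us \<in> bases K (U z)" "Ws \<in> bases K (W z)"
      using exists_base[OF subf rank_dist_dimension[OF c(1) zv]]
        exists_base[OF subf rank_dist_dimension[OF c(2) zv]]
      unfolding U_def W_def bases_def by auto
    show "dimension s K (U z)" "dimension t K (W z)"
      using app(2,3)[OF z B] B dimensionI[OF subf] unfolding bases_def by blast+
  qed
  have coord_U: "c1 ! i \<ominus> z ! i \<in> U z" and coord_W: "c2 ! i \<ominus> z ! i \<in> W z"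
    if "z \<in> A" "i < n" for z i
    using Span_base_incl[OF subf vec_diff_in_carrier[OF c(1)], of z]
      Span_base_incl[OF subf vec_diff_in_carrier[OF c(2)], of z] that
      set_vec_diff[OF c(1), of z] set_vec_diff[OF c(2), of z]
    unfolding A U_def W_def by auto
  have "inj_on (\<lambda>(z, Us, Ws). Us @ Ws) ?P"
  proof (rule inj_onI)
    fix p p' assume "p \<in> ?P" "p' \<in> ?P" "(\<lambda>(z, Us, Ws). Us @ Ws) p = (\<lambda>(z, Us, Ws). Us @ Ws) p'"
    then obtain z Us Ws z' Us' Ws' where p: "p = (z, Us, Ws)" "p' = (z', Us', Ws')"
      and z: "z \<in> A" "z' \<in> A"
      and B: "Us \<in> bases K (U z)" "Ws \<in> bases K (W z)"
      and B': "Us' \<in> bases K (U z')" "Ws' \<in> bases K (W z')"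
      and eq: "Us @ Ws = Us' @ Ws'"
      by auto
    \<comment> \<open>Both first parts have length \<open>s\<close>, so the two concatenations split
      at the same place.\<close>
    have UW: "Us = Us'" "Ws = Ws'"
      using eq app(2)[OF z(1) B] app(2)[OF z(2) B'] by auto
    have inter: "Span K Us \<inter> Span K Ws = {\<zero>}"
      using app(1)[OF z(1) B] independent_split(3)[OF subf] by (simp add: bases_def)
    have U: "U z = Span K Us" "U z' = Span K Us" and W: "W z = Span K Ws" "W z' = Span K Ws"
      using B B' UW by (auto simp: bases_def)
    have "z = z'"
    proof (rule nth_equalityI)
      show "length z = length z'" using z by (simp add: A vectors_def)
      fix i assume "i < length z"
      then have i: "i < n" using z by (simp add: A vectors_def)
      have carr: "c1 ! i \<in> carrier R" "c2 ! i \<in> carrier R" "z ! i \<in> carrier R" "z' ! i \<in> carrier R"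
        using c z i by (auto simp: A vectors_def)
      \<comment> \<open>The difference of \<open>z\<close> and \<open>z'\<close> at \<open>i\<close>
        is independent of whether it is computed through \<open>c1\<close> or \<open>c2\<close>, so
        it lies in both spans, which meet only in zero.\<close>
      have "(c1 ! i \<ominus> z' ! i) \<ominus> (c1 ! i \<ominus> z ! i) \<in> Span K Us"
        using a_minus_in_Span[OF bases_in_carrier[OF B(1)]] coord_U z i U by metis
      moreover have "(c1 ! i \<ominus> z' ! i) \<ominus> (c1 ! i \<ominus> z ! i) = z ! i \<ominus> z' ! i"
        using carr by algebra
      moreover have "(c2 ! i \<ominus> z' ! i) \<ominus> (c2 ! i \<ominus> z ! i) \<in> Span K Ws"
        using a_minus_in_Span[OF bases_in_carrier[OF B(2)]] coord_W z i W by metis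
      moreover have "(c2 ! i \<ominus> z' ! i) \<ominus> (c2 ! i \<ominus> z ! i) = z ! i \<ominus> z' ! i"
        using carr by algebra
      ultimately have "z ! i \<ominus> z' ! i = \<zero>" using inter by auto
      then show "z ! i = z' ! i" using carr by simp
    qed
    then show "p = p'" using UW p by simp
  qed
  moreover have "(\<lambda>(z, Us, Ws). Us @ Ws) ` ?P = bases K V"
  proof (intro equalityI subsetI)
    fix Vs assume Vs: "Vs \<in> bases K V"
    define Us Ws where UW: "Us = take s Vs" "Ws = drop s Vs"
    have len: "length Us = s" "length Ws = t" and Vs_eq: "Vs = Us @ Ws"
      using length_bases[OF dimV Vs] by (auto simp: UW)
    have app_Vs: "independent K (Us @ Ws)" "Span K (Us @ Ws) = V"
      using Vs unfolding bases_def Vs_eq by blast+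
    note ind = independent_split(2,1)[OF subf app_Vs(1)]
    note carr = independent_in_carrier[OF ind(1)] independent_in_carrier[OF ind(2)]
    have V_sum: "V = Span K Us <+> Span K Ws"
      using app_Vs(2) Span_append_eq_set_add[OF subf carr] by simp
    have "\<exists>u. u \<in> Span K Us \<and> (\<exists>w \<in> Span K Ws. c1 ! i \<ominus> c2 ! i = u \<oplus> w)" if "i < n" for i
    proof -
      have "c1 ! i \<ominus> c2 ! i \<in> V"
        using Span_base_incl[OF subf vec_diff_in_carrier[OF c]] set_vec_diff[OF c] that
        by (auto simp: V_def)
      then show ?thesis unfolding V_sum set_add_def' by blast
    qed
    then obtain u where u: "\<And>i. i < n \<Longrightarrow> u i \<in> Span K Us"
        "\<And>i. i < n \<Longrightarrow> \<exists>w \<in> Span K Ws. c1 ! i \<ominus> c2 ! i = u i \<oplus> w"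
      by metis
    \<comment> \<open>Removing from \<open>c1\<close> the component \<open>u\<close> of
      \<open>c1 - c2\<close> in \<open>Span K Us\<close> makes \<open>c1 - z\<close> equal to
      \<open>u\<close> and \<open>c2 - z\<close> equal to \<open>- w\<close>,
      coordinatewise.\<close>
    define z where "z = map (\<lambda>i. c1 ! i \<ominus> u i) [0..<n]"
    have ucarr: "u i \<in> carrier R" if "i < n" for i
      using u(1)[OF that] Span_subgroup_props(1)[OF subf carr(1)] by blast
    have c_nth: "c1 ! i \<in> carrier R" "c2 ! i \<in> carrier R" if "i < n" for i
      using c that by (auto simp: vectors_def)
    have zv: "z \<in> vectors R n"
      using ucarr c_nth by (auto simp: z_def vectors_def)
    have sub1: "set (vec_diff c1 z) \<subseteq> Span K Us"
    proof
      fix v assume "v \<in> set (vec_diff c1 z)"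
      then obtain i where i: "i < n" "v = c1 ! i \<ominus> (c1 ! i \<ominus> u i)"
        using set_vec_diff[OF c(1) zv] by (auto simp: z_def)
      have "v = u i" using i(2) c_nth[OF i(1)] ucarr[OF i(1)] by algebra
      then show "v \<in> Span K Us" using u(1)[OF i(1)] by simp
    qed
    have sub2: "set (vec_diff c2 z) \<subseteq> Span K Ws"
    proof
      fix v assume "v \<in> set (vec_diff c2 z)"
      then obtain i where i: "i < n" "v = c2 ! i \<ominus> (c1 ! i \<ominus> u i)"
        using set_vec_diff[OF c(2) zv] by (auto simp: z_def)
      obtain w where w: "w \<in> Span K Ws" "c1 ! i \<ominus> c2 ! i = u i \<oplus> w"
        using u(2)[OF i(1)] by auto
      have wc: "w \<in> carrier R" using w(1) Span_subgroup_props(1)[OF subf carr(2)] by blast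
      have "v = u i \<ominus> (c1 ! i \<ominus> c2 ! i)"
        using i(2) c_nth[OF i(1)] ucarr[OF i(1)] by algebra
      also have "\<dots> = \<ominus> w"
        unfolding w(2) using ucarr[OF i(1)] wc by algebra
      finally show "v \<in> Span K Ws" using w(1) Span_subgroup_props(4)[OF subf carr(2)] by simp
    qed
    have zA: "z \<in> A"
      using rk_le_length[OF ind(1) sub1] rk_le_length[OF ind(2) sub2] zv len
      by (simp add: A rank_dist_def)
    \<comment> \<open>So far only one inclusion is known; since \<open>z\<close> is in
      \<open>A\<close>, both sides have dimension \<open>s\<close>.\<close>
    have "U z = Span K Us"
      by (rule Span_eq_if_dimension_eq[OF dims(1)[OF zA]])
        (use dimension_independent[OF ind(1)] len mono_Span_subset[OF subf sub1 carr(1)] in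
          \<open>auto simp: U_def\<close>)
    moreover have "W z = Span K Ws"
      by (rule Span_eq_if_dimension_eq[OF dims(2)[OF zA]])
        (use dimension_independent[OF ind(2)] len mono_Span_subset[OF subf sub2 carr(2)] in
          \<open>auto simp: W_def\<close>)
    ultimately have "(z, Us, Ws) \<in> ?P"
      using zA ind by (simp add: bases_def)
    then show "Vs \<in> (\<lambda>(z, Us, Ws). Us @ Ws) ` ?P"
      using Vs_eq by force
  qed (use app(1) in auto)
  ultimately have "card (bases K V) = card ?P"
    by (metis (no_types, lifting) card_image)
  have fin_bases: "finite (bases K E)" if "dimension k K E" for k E
    by (rule finite_subset[OF _ finite_lists_length_eq[OF fin, of k]])
      (use length_bases[OF that] bases_in_carrier in auto)
  have "real (card ?P) = (\<Sum>z\<in>A. real (card (bases K (U z))) * real (card (bases K (W z))))"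
    using finA fin_bases[OF dims(1)] fin_bases[OF dims(2)]
    by (subst card_SigmaI) (auto simp: card_cartesian_product)
  also have "\<dots> = (\<Sum>z\<in>A. frame_count (card K) s * frame_count (card K) t)"
    using card_bases[OF fin dims(1)] card_bases[OF fin dims(2)] by simp
  finally show ?thesis
    using card_bases[OF fin dimV] \<open>card (bases K V) = card ?P\<close> by (simp add: A_def)
qed

end

theorem proposition4:
  fixes R :: "('a, 'b) ring_scheme" and K :: "'a set"
    and q m n r s :: nat and c1 c2 :: "'a list"
  assumes "primepow q" and "m \<ge> 1" and "n \<ge> 1"
    and "field R" and "finite (carrier R)" and "card (carrier R) = q ^ m"
    and "subfield K R" and "card K = q"
    and "c1 \<in> vectors R n" and "c2 \<in> vectors R n"
    and "rank_dist R K c1 c2 = r"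
    and "s \<le> r"
  shows "real (card (rank_ball R K n s c1 \<inter> rank_ball R K n (r - s) c2)) =
           real q ^ (s * (r - s)) * gauss_binomial q r s"
proof -
  interpret field R by fact
  interpret embedded_algebra K R
    using assms(7) ring_axioms by (simp add: embedded_algebra_def)
  have q: "q > 1" using assms(1) primepow_gt_Suc_0 by auto
  \<comment> \<open>Taking \<open>r - s\<close> for \<open>t\<close>, the hypothesis
    \<open>s \<le> r\<close> gives \<open>s + t = r\<close>.\<close>
  have "real (card (rank_ball R K n s c1 \<inter> rank_ball R K n (r - s) c2))
          * (frame_count q s * frame_count q (r - s)) = frame_count q r"
    using card_rank_ball_inter_bases[of c1 n c2 s "r - s"] assms by simp
  moreover have "frame_count q s * frame_count q (r - s) \<noteq> 0"
    using frame_count_pos[OF q, of s] frame_count_pos[OF q, of "r - s"] by simp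
  ultimately have "real (card (rank_ball R K n s c1 \<inter> rank_ball R K n (r - s) c2))
      = frame_count q r / (frame_count q s * frame_count q (r - s))"
    by (simp add: nonzero_eq_divide_eq)
  then show ?thesis
    using gauss_binomial_frame_count[OF q, of s "r - s"] assms(12) by simp
qed

end
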